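(* Let $x^\dagger$ satisfy the source condition: there is $w\in Y$ with $\xi:=A^*w\in\partial\mathcal R(x^\dagger)$. For noisy data $y^\delta$ with $\|y^\delta-y\|\le\delta$, let $\alpha_*=\alpha_*(y^\delta)$ be a minimiser over $(0,\alpha_{\max})$ of the Hanke-Raus functional $\psi_{\rm HR}(\alpha,y^\delta)=\frac1\alpha\langle y^\delta-Ax^{II}_{\alpha,\delta},\,y^\delta-Ax^\delta_\alpha\rangle$. Suppose that there exists a constant $C>0$ such that $$D_{\xi_\alpha}(x^\delta_\alpha,x_\alpha)\le C\,\frac1\alpha\langle\Delta p^{II}_\alpha,\Delta p_\alpha\rangle$$ for all $\alpha\in(0,\alpha_{\max})$ and $y^\delta\in Y$. Then $$D_\xi(x^\delta_{\alpha_*},x^\dagger)\to0\qquad\text{as }\delta\to0.$$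
   Context: $X$ is a Banach space, $Y$ a Hilbert space, $A:X\to Y$ a continuous linear operator with adjoint $A^*:Y\to X^*$. The functional $\mathcal R:X\to\mathbb R\cup\{\infty\}$ is convex, proper, coercive and weak-$*$ lower semicontinuous (these properties ensure that the minimisers below exist). $\alpha_{\max}>0$ is fixed. $y\in Y$ denotes exact data and $x^\dagger\in X$ an $\mathcal R$-minimising solution: $Ax^\dagger=y$ and $\mathcal R(x^\dagger)=\min\{\mathcal R(x):Ax=y\}$. For $\eta\in\partial\mathcal R(x_2)$ the Bregman distance is $D_\eta(x_1,x_2)=\mathcal R(x_1)-\mathcal R(x_2)-\langle\eta,x_1-x_2\rangle_{X^*\times X}$. For $\alpha\in(0,\alpha_{\max})$ and $y^\delta\in Y$: $x_\alpha^\delta\in\operatorname{argmin}_{x}\frac12\|Ax-y^\delta\|^2+\alpha\mathcal R(x)$, with subgradient $\xi_\alpha^\delta=-\frac1\alpha A^*(Ax_\alpha^\delta-y^\delta)\in\partial\mathcal R(x_\alpha^\delta)$; the second Bregman iterate is $x^{II}_{\alpha,\delta}\in\operatorname{argmin}_{x}\frac12\|Ax-y^\delta\|^2+\alpha D_{\xi_\alpha^\delta}(x,x_\alpha^\delta)$. The quantities $x_\alpha,\xi_\alpha,x^{II}_\alpha$ are defined in the same way with $y$ in place of $y^\delta$. Residuals: $p_\alpha^\delta=y^\delta-Ax_\alpha^\delta$, $p_\alpha=y-Ax_\alpha$, $p^{II}_{\alpha,\delta}=y^\delta-Ax^{II}_{\alpha,\delta}$, $p^{II}_\alpha=y-Ax^{II}_\alpha$;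 differences: $\Delta p_\alpha=p_\alpha^\delta-p_\alpha$, $\Delta p^{II}_\alpha=p^{II}_{\alpha,\delta}-p^{II}_\alpha$. *)

theory Defs
  imports "HOL-Analysis.Analysis"
begin

definition proper_fun :: "('x \<Rightarrow> ereal) \<Rightarrow> bool" where
  "proper_fun R \<longleftrightarrow> (\<forall>x. R x \<noteq> -\<infinity>) \<and> (\<exists>x. R x \<noteq> \<infinity>)"

text \<open>The library's \<open>convex_on\<close> is restricted to real-valued functions. The endpoints
  \<open>u = 0\<close> and \<open>v = 0\<close> are harmless because \<open>0 * \<infinity> = 0\<close> in \<^typ>\<open>ereal\<close>.\<close>

definition convex_fun :: "('x::real_vector \<Rightarrow> ereal) \<Rightarrow> bool" where
  "convex_fun R \<longleftrightarrow> (\<forall>x y u v. 0 \<le> u \<longrightarrow> 0 \<le> v \<longrightarrow> u + v = 1 \<longrightarrow>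
     R (u *\<^sub>R x + v *\<^sub>R y) \<le> ereal u * R x + ereal v * R y)"

definition coercive :: "('x::real_normed_vector \<Rightarrow> ereal) \<Rightarrow> bool" where
  "coercive R \<longleftrightarrow> (R \<longlongrightarrow> \<infinity>) at_infinity"

definition lsc_in :: "'x topology \<Rightarrow> ('x \<Rightarrow> ereal) \<Rightarrow> bool" where
  "lsc_in T R \<longleftrightarrow> (\<forall>c. closedin T {x \<in> topspace T. R x \<le> c})"

text \<open>A weak-* topology on a Banach space refers to a predual: an isometric isomorphism \<open>J\<close> of the
  space onto the dual of a Banach space.\<close>

definition dual_identification ::
    "('x::real_normed_vector \<Rightarrow> ('z::real_normed_vector \<Rightarrow>\<^sub>L real)) \<Rightarrow> bool" where
  "dual_identification J \<longleftrightarrow> linear J \<and> (\<forall>x. norm (J x) = norm x) \<and> surj J"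

text \<open>For functionals, the strong operator topology is the topology of pointwise convergence on the
  predual, i.e. the weak-* topology.\<close>

definition weak_star_topology ::
    "('x \<Rightarrow> ('z::real_normed_vector \<Rightarrow>\<^sub>L real)) \<Rightarrow> 'x topology" where
  "weak_star_topology J = pullback_topology UNIV J strong_operator_topology"

definition dual_adjoint ::
    "('x::real_normed_vector \<Rightarrow>\<^sub>L 'y::real_inner) \<Rightarrow> 'y \<Rightarrow> ('x \<Rightarrow>\<^sub>L real)" where
  "dual_adjoint A w = blinfun_inner_left w o\<^sub>L A"

lemma dual_adjoint_apply: "dual_adjoint A w x = w \<bullet> A x"
  by (simp add: dual_adjoint_def inner_commute)

definition subdifferential ::
    "('x::real_normed_vector \<Rightarrow> ereal) \<Rightarrow> 'x \<Rightarrow> ('x \<Rightarrow>\<^sub>L real) set" where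
  "subdifferential R x =
     {\<eta>. \<bar>R x\<bar> \<noteq> \<infinity> \<and> (\<forall>z. R x + ereal (blinfun_apply \<eta> (z - x)) \<le> R z)}"

definition bregman_dist ::
    "('x::real_normed_vector \<Rightarrow> ereal) \<Rightarrow> ('x \<Rightarrow>\<^sub>L real) \<Rightarrow> 'x \<Rightarrow> 'x \<Rightarrow> ereal" where
  "bregman_dist R \<eta> x1 x2 = R x1 - R x2 - ereal (\<eta> (x1 - x2))"

definition tikhonov_fun ::
    "('x::real_normed_vector \<Rightarrow>\<^sub>L 'y::real_inner) \<Rightarrow> ('x \<Rightarrow> ereal) \<Rightarrow> real \<Rightarrow> 'y \<Rightarrow> 'x \<Rightarrow> ereal" where
  "tikhonov_fun A R \<alpha> v x = ereal (1/2 * (norm (A x - v))\<^sup>2) + ereal \<alpha> * R x"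

definition tikhonov_subgrad ::
    "('x::real_normed_vector \<Rightarrow>\<^sub>L 'y::real_inner) \<Rightarrow> real \<Rightarrow> 'y \<Rightarrow> 'x \<Rightarrow> ('x \<Rightarrow>\<^sub>L real)" where
  "tikhonov_subgrad A \<alpha> v u = - (1 / \<alpha>) *\<^sub>R dual_adjoint A (A u - v)"

text \<open>Here \<open>u\<close> is the first iterate (the Tikhonov minimiser).\<close>

definition bregman_step_fun ::
    "('x::real_normed_vector \<Rightarrow>\<^sub>L 'y::real_inner) \<Rightarrow> ('x \<Rightarrow> ereal) \<Rightarrow> real \<Rightarrow> 'y \<Rightarrow> 'x \<Rightarrow> 'x \<Rightarrow> ereal" where
  "bregman_step_fun A R \<alpha> v u x =
     ereal (1/2 * (norm (A x - v))\<^sup>2) + ereal \<alpha> * bregman_dist R (tikhonov_subgrad A \<alpha> v u) x u"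

definition residual :: "('x::real_normed_vector \<Rightarrow>\<^sub>L 'y::real_inner) \<Rightarrow> 'y \<Rightarrow> 'x \<Rightarrow> 'y" where
  "residual A v x = v - A x"

text \<open>\<open>X1 \<alpha> v\<close> and \<open>X2 \<alpha> v\<close> are the first and second Bregman iterates for parameter \<open>\<alpha>\<close>
  and data \<open>v\<close>.\<close>

definition hanke_raus ::
    "('x::real_normed_vector \<Rightarrow>\<^sub>L 'y::real_inner) \<Rightarrow> (real \<Rightarrow> 'y \<Rightarrow> 'x) \<Rightarrow> (real \<Rightarrow> 'y \<Rightarrow> 'x)
      \<Rightarrow> real \<Rightarrow> 'y \<Rightarrow> real" where
  "hanke_raus A X1 X2 \<alpha> v =
     1 / \<alpha> * (residual A v (X2 \<alpha> v) \<bullet> residual A v (X1 \<alpha> v))"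

end

theory Submission
  imports Defs
begin

text \<open>Write \<open>p \<alpha> v\<close> for the residual of the Tikhonov minimiser. It is firmly nonexpansive in \<open>v\<close>, and
  the second Bregman iterate is the Tikhonov minimiser for the data \<open>v + p \<alpha> v\<close>, so the Hanke-Raus
  functional dominates the squared norm of the second residual \<open>p2 \<alpha> v\<close> divided by \<open>\<alpha>\<close>. Comparing with
  \<open>\<alpha> = \<delta>\<close> shows that its minimum is \<open>O(\<delta>)\<close>, hence \<open>p2\<close> at \<open>\<alpha>star \<delta>\<close> tends to \<open>0\<close>, for noisy and for
  exact data. The three-point identity for Bregman distances then reduces the claim to \<open>p \<alpha> y \<longlongrightarrow> 0\<close> along
  \<open>\<alpha> = \<alpha>star \<delta>\<close>.

  This last limit is the delicate point, since \<open>\<alpha>star \<delta>\<close> need not tend to \<open>0\<close>. If \<open>p2 \<alpha> y\<close> tends to \<open>0\<close>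
  along parameters for which \<open>p \<alpha> y\<close> stays away from \<open>0\<close>, monotonicity of the subdifferential forces
  \<open>p \<alpha> y = \<alpha> q\<close> for all small \<open>\<alpha>\<close> with a fixed \<open>q \<noteq> 0\<close>. Letting \<open>\<alpha>\<close> tend to \<open>0\<close> in the
  auto-regularisation condition, whose constant is uniform in \<open>\<alpha>\<close> and in the data, shows that \<open>R\<close> is affine
  with slope \<open>q\<close> on all points having a subgradient in the range of the adjoint. Since \<open>R\<close> is bounded below
  there are such subgradients \<open>r\<close> arbitrarily close to \<open>0\<close>, and the condition at the midpoint subgradient
  \<open>(q + r) / 2\<close> yields \<open>norm q \<le> 3 * norm r\<close>, a contradiction.\<close>

section \<open>Subgradients in the range of the adjoint\<close>

text \<open>Carrying the element \<open>q\<close> of \<open>'y\<close> in place of the functional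
  turns every dual pairing into an inner product, so that the estimates below can all be made in the
  data space.\<close>

definition range_subgradient ::
    "('x::real_normed_vector \<Rightarrow>\<^sub>L 'y::real_inner) \<Rightarrow> ('x \<Rightarrow> ereal) \<Rightarrow> 'x \<Rightarrow> 'y \<Rightarrow> bool" where
  "range_subgradient A R x q \<longleftrightarrow> dual_adjoint A q \<in> subdifferential R x"

lemma range_subgradient_finite: "range_subgradient A R x q \<Longrightarrow> \<bar>R x\<bar> \<noteq> \<infinity>"
  by (simp add: range_subgradient_def subdifferential_def)

lemma range_subgradient_ineq:
  fixes A :: "'x::real_normed_vector \<Rightarrow>\<^sub>L 'y::real_inner"
  shows   "range_subgradient A R x q \<Longrightarrow> R x + ereal (q \<bullet> (A z - A x)) \<le> R z"
  by (simp add: range_subgradient_def subdifferential_def dual_adjoint_apply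
      blinfun.diff_right inner_diff_right)

lemma range_subgradient_real_ineq:
  fixes A :: "'x::real_normed_vector \<Rightarrow>\<^sub>L 'y::real_inner"
  assumes "range_subgradient A R x q" "\<bar>R z\<bar> \<noteq> \<infinity>"
  shows "real_of_ereal (R x) + q \<bullet> (A z - A x) \<le> real_of_ereal (R z)"
  using range_subgradient_ineq[OF assms(1), of z] range_subgradient_finite[OF assms(1)] assms(2)
  by (cases "R x"; cases "R z") auto

lemma range_subgradientI:
  fixes A :: "'x::real_normed_vector \<Rightarrow>\<^sub>L 'y::real_inner"
  assumes "\<bar>R x\<bar> \<noteq> \<infinity>" "\<And>z. R x + ereal (q \<bullet> (A z - A x)) \<le> R z"
  shows "range_subgradient A R x q"
  using assms
  by (simp add: range_subgradient_def subdifferential_def dual_adjoint_apply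
      blinfun.diff_right inner_diff_right)

lemma range_subgradient_monotone:
  fixes A :: "'x::real_normed_vector \<Rightarrow>\<^sub>L 'y::real_inner"
  assumes "range_subgradient A R x q" "range_subgradient A R x' q'"
  shows "0 \<le> (A x - A x') \<bullet> (q - q')"
  using range_subgradient_real_ineq[OF assms(1) range_subgradient_finite[OF assms(2)]]
    range_subgradient_real_ineq[OF assms(2) range_subgradient_finite[OF assms(1)]]
  by (simp add: inner_diff inner_commute)

section \<open>Optimality and uniqueness of Tikhonov minimisers\<close>

lemma nonpos_of_le_mult_small:
  fixes a b c :: real
  assumes "0 < c" "\<And>t. 0 < t \<Longrightarrow> t < c \<Longrightarrow> a \<le> t * b"
  shows "a \<le> 0"
proof (rule tendsto_lowerbound[of "\<lambda>t. t * b"])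
  show "\<forall>\<^sub>F t in at_right 0. a \<le> t * b"
    using assms by (intro eventually_at_right_field[THEN iffD2]) auto
  show "((\<lambda>t. t * b) \<longlongrightarrow> 0) (at_right 0)"
    by (auto intro!: tendsto_eq_intros)
qed simp

text \<open>First variation along the segment from \<open>x\<close> to \<open>z\<close>: convexity
  bounds \<open>R\<close> at the intermediate point, the quadratic term is expanded, and after
  division by \<open>t\<close> only a remainder of order \<open>t\<close> is left.\<close>

lemma tikhonov_min_range_subgradient:
  assumes cvx: "convex_fun R" and prp: "proper_fun R" and "0 < \<alpha>"
    and min: "is_arg_min (tikhonov_fun A R \<alpha> v) (\<lambda>_. True) x"
  shows "range_subgradient A R x ((1 / \<alpha>) *\<^sub>R (v - A x))"
proof (rule range_subgradientI)
  have le: "tikhonov_fun A R \<alpha> v x \<le> tikhonov_fun A R \<alpha> v z" for z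
    using min by (auto simp: is_arg_min_linorder)
  obtain z0 where "R z0 \<noteq> \<infinity>" using prp by (auto simp: proper_fun_def)
  moreover have ninf: "R z \<noteq> -\<infinity>" for z using prp by (auto simp: proper_fun_def)
  ultimately show fin: "\<bar>R x\<bar> \<noteq> \<infinity>"
    using le[of z0] ninf[of x] ninf[of z0] \<open>0 < \<alpha>\<close> unfolding tikhonov_fun_def
    by (cases "R x"; cases "R z0") auto
  fix z
  show "R x + ereal (((1 / \<alpha>) *\<^sub>R (v - A x)) \<bullet> (A z - A x)) \<le> R z"
  proof (cases "R z")
    case (real c)
    obtain b where b: "R x = ereal b" using fin by (cases "R x") auto
    define d where "d = A z - A x"
    have small: "- (\<alpha> * (c - b) + (A x - v) \<bullet> d) \<le> t * (1/2 * (d \<bullet> d))"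
      if t: "0 < t" "t < 1" for t
    proof -
      define xt where "xt = (1 - t) *\<^sub>R x + t *\<^sub>R z"
      have "R xt \<le> ereal (1 - t) * R x + ereal t * R z"
        using cvx t unfolding convex_fun_def xt_def by force
      then have up: "R xt \<le> ereal ((1 - t) * b + t * c)" by (simp add: b real)
      then obtain r where r: "R xt = ereal r" using ninf[of xt] by (cases "R xt") auto
      have "A xt - v = (A x - v) + t *\<^sub>R d"
        unfolding xt_def d_def blinfun.add_right blinfun.scaleR_right by (simp add: algebra_simps)
      then have "(norm (A xt - v))\<^sup>2 = (norm (A x - v))\<^sup>2 + 2 * t * ((A x - v) \<bullet> d) + t\<^sup>2 * (d \<bullet> d)"
        by (simp only: power2_norm_eq_inner)
        (simp add: inner_add inner_commute power2_eq_square distrib_left mult.assoc)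
      moreover have "1/2 * (norm (A x - v))\<^sup>2 + \<alpha> * b \<le> 1/2 * (norm (A xt - v))\<^sup>2 + \<alpha> * r"
        using le[of xt] by (simp add: tikhonov_fun_def b r)
      moreover have "\<alpha> * r \<le> \<alpha> * ((1 - t) * b + t * c)"
        using up r \<open>0 < \<alpha>\<close> by simp
      ultimately have "0 \<le> t * ((\<alpha> * (c - b) + (A x - v) \<bullet> d) + t * (1/2 * (d \<bullet> d)))"
        by (simp add: algebra_simps power2_eq_square)
      then show ?thesis using t by (simp add: zero_le_mult_iff)
    qed
    have "- (\<alpha> * (c - b) + (A x - v) \<bullet> d) \<le> 0"
      by (rule nonpos_of_le_mult_small[OF zero_less_one small])
    then have "b + (v - A x) \<bullet> d / \<alpha> \<le> c"
      using \<open>0 < \<alpha>\<close> by (simp add: field_simps inner_diff_left)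
    then show ?thesis by (simp add: b real d_def)
  qed (use ninf in auto)
qed

text \<open>The data are built so that \<open>x\<close> meets the optimality condition with
  subgradient \<open>r\<close>. For another minimiser \<open>x'\<close> the subgradients differ by
  \<open>(A x - A x') / \<alpha>\<close>, and monotonicity makes this vanish. Thus every pair of a
  point and a subgradient can be realised, up to \<open>A\<close> and \<open>R\<close>, by a choice
  of data.\<close>

lemma tikhonov_min_unique:
  fixes A :: "'x::real_normed_vector \<Rightarrow>\<^sub>L 'y::real_inner"
  assumes "convex_fun R" "proper_fun R" "0 < \<alpha>"
    and min: "is_arg_min (tikhonov_fun A R \<alpha> (A x + \<alpha> *\<^sub>R r)) (\<lambda>_. True) x'"
    and r: "range_subgradient A R x r"
  shows "A x' = A x" "R x' = R x"
proof -
  let ?r' = "(1 / \<alpha>) *\<^sub>R (A x + \<alpha> *\<^sub>R r - A x')"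
  have r': "range_subgradient A R x' ?r'"
    by (rule tikhonov_min_range_subgradient) fact+
  have "?r' - r = (1 / \<alpha>) *\<^sub>R (A x - A x')"
    using \<open>0 < \<alpha>\<close> by (simp add: algebra_simps)
  then have "0 \<le> (A x' - A x) \<bullet> ((1 / \<alpha>) *\<^sub>R (A x - A x'))"
    using range_subgradient_monotone[OF r' r] by simp
  also have "\<dots> = - ((norm (A x' - A x))\<^sup>2 / \<alpha>)"
    unfolding power2_norm_eq_inner inner_scaleR_right minus_diff_eq[of "A x'" "A x", symmetric]
      inner_minus_right by simp
  finally show eq: "A x' = A x"
    using \<open>0 < \<alpha>\<close> by (simp add: divide_le_0_iff)
  show "R x' = R x"
    using range_subgradient_ineq[OF r, of x'] range_subgradient_ineq[OF r', of x]
    by (simp add: eq flip: zero_ereal_def)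
qed

text \<open>Completing the square: the Bregman step is a Tikhonov step in which the first residual is added
  back to the data.\<close>

lemma bregman_step_fun_eq_tikhonov_fun:
  assumes "0 < \<alpha>" "\<bar>R u\<bar> \<noteq> \<infinity>"
  shows "\<exists>c. \<forall>x. bregman_step_fun A R \<alpha> v u x =
           tikhonov_fun A R \<alpha> (v + residual A v u) x + ereal c"
proof -
  obtain b where b: "R u = ereal b" using assms(2) by (cases "R u") auto
  define p where "p = v - A u"
  have "bregman_step_fun A R \<alpha> v u x = tikhonov_fun A R \<alpha> (v + residual A v u) x
      + ereal (p \<bullet> A u - p \<bullet> v - 1/2 * (p \<bullet> p) - \<alpha> * b)" for x
  proof -
    have "tikhonov_subgrad A \<alpha> v u (x - u) = 1 / \<alpha> * (p \<bullet> A x - p \<bullet> A u)"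
      by (simp add: tikhonov_subgrad_def p_def dual_adjoint_apply blinfun.bilinear_simps inner_diff
          algebra_simps diff_divide_distrib)
    then have "\<alpha> * tikhonov_subgrad A \<alpha> v u (x - u) = p \<bullet> A x - p \<bullet> A u"
      using assms(1) by simp
    moreover have "(norm (A x - (v + p)))\<^sup>2
        = (norm (A x - v))\<^sup>2 - 2 * (p \<bullet> A x - p \<bullet> v) + p \<bullet> p"
      by (simp add: power2_norm_eq_inner inner_diff inner_add inner_commute)
    ultimately have sq: "1/2 * (norm (A x - v))\<^sup>2 + \<alpha> * (r - b - tikhonov_subgrad A \<alpha> v u (x - u))
        = 1/2 * (norm (A x - (v + p)))\<^sup>2 + \<alpha> * r + (p \<bullet> A u - p \<bullet> v - 1/2 * (p \<bullet> p) - \<alpha> * b)" for r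
      by (simp add: right_diff_distrib) argo
    show ?thesis
    proof (cases "R x")
      case (real r)
      then show ?thesis
        using sq by (simp add: bregman_step_fun_def tikhonov_fun_def bregman_dist_def b residual_def p_def)
    qed (use assms(1) in \<open>simp_all add: bregman_step_fun_def tikhonov_fun_def bregman_dist_def b\<close>)
  qed
  then show ?thesis by blast
qed

section \<open>Residuals of the two Bregman iterates\<close>

locale bregman_iteration =
  fixes A :: "'x::real_normed_vector \<Rightarrow>\<^sub>L 'y::real_inner"
    and R :: "'x \<Rightarrow> ereal"
    and \<alpha>max :: real
    and X1 X2 :: "real \<Rightarrow> 'y \<Rightarrow> 'x"
  assumes R_convex: "convex_fun R"
    and R_proper: "proper_fun R"
    and X1_min: "\<And>\<alpha> v. \<alpha> \<in> {0<..<\<alpha>max} \<Longrightarrow>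
          is_arg_min (tikhonov_fun A R \<alpha> v) (\<lambda>_. True) (X1 \<alpha> v)"
    and X2_min: "\<And>\<alpha> v. \<alpha> \<in> {0<..<\<alpha>max} \<Longrightarrow>
          is_arg_min (bregman_step_fun A R \<alpha> v (X1 \<alpha> v)) (\<lambda>_. True) (X2 \<alpha> v)"
begin

definition res1 :: "real \<Rightarrow> 'y \<Rightarrow> 'y" where "res1 \<alpha> v = residual A v (X1 \<alpha> v)"
definition res2 :: "real \<Rightarrow> 'y \<Rightarrow> 'y" where "res2 \<alpha> v = residual A v (X2 \<alpha> v)"

lemma A_X1: "A (X1 \<alpha> v) = v - res1 \<alpha> v" and A_X2: "A (X2 \<alpha> v) = v - res2 \<alpha> v"
  by (simp_all add: res1_def res2_def residual_def)

lemma X1_subgradient: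
  assumes "\<alpha> \<in> {0<..<\<alpha>max}"
  shows "range_subgradient A R (X1 \<alpha> v) ((1 / \<alpha>) *\<^sub>R res1 \<alpha> v)"
  using tikhonov_min_range_subgradient[OF R_convex R_proper _ X1_min[OF assms]] assms
  by (simp add: res1_def residual_def)

lemma X1_unique:
  assumes "\<alpha> \<in> {0<..<\<alpha>max}" "range_subgradient A R x r"
  shows "res1 \<alpha> (A x + \<alpha> *\<^sub>R r) = \<alpha> *\<^sub>R r" "R (X1 \<alpha> (A x + \<alpha> *\<^sub>R r)) = R x"
  using tikhonov_min_unique[OF R_convex R_proper _ X1_min[OF assms(1)] assms(2)] assms(1)
  by (simp_all add: res1_def residual_def)

text \<open>The data split as \<open>v = A x + p\<close> with \<open>x = X1 \<alpha> v\<close> and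
  \<open>p / \<alpha>\<close> a subgradient at \<open>x\<close>. So \<open>p\<close> is a resolvent
  of a monotone relation at \<open>v\<close>, and monotonicity rewritten in \<open>p\<close> is the
  claim.\<close>

lemma res1_firmly_nonexpansive:
  assumes "\<alpha> \<in> {0<..<\<alpha>max}"
  shows "(norm (res1 \<alpha> u - res1 \<alpha> v))\<^sup>2 \<le> (res1 \<alpha> u - res1 \<alpha> v) \<bullet> (u - v)"
proof -
  have "0 \<le> (A (X1 \<alpha> u) - A (X1 \<alpha> v)) \<bullet> ((1/\<alpha>) *\<^sub>R res1 \<alpha> u - (1/\<alpha>) *\<^sub>R res1 \<alpha> v)"
    by (intro range_subgradient_monotone[of _ R] X1_subgradient assms)
  also have "\<dots> = ((u - res1 \<alpha> u - (v - res1 \<alpha> v)) \<bullet> (res1 \<alpha> u - res1 \<alpha> v)) / \<alpha>"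
    by (simp add: A_X1 flip: scaleR_diff_right)
  finally show ?thesis
    using assms by (simp add: zero_le_divide_iff power2_norm_eq_inner inner_diff inner_commute)
qed

lemma res1_nonexpansive:
  assumes "\<alpha> \<in> {0<..<\<alpha>max}"
  shows "norm (res1 \<alpha> u - res1 \<alpha> v) \<le> norm (u - v)"
proof -
  have "norm (res1 \<alpha> u - res1 \<alpha> v) * norm (res1 \<alpha> u - res1 \<alpha> v)
      \<le> norm (res1 \<alpha> u - res1 \<alpha> v) * norm (u - v)"
    using res1_firmly_nonexpansive[OF assms, of u v]
      norm_cauchy_schwarz[of "res1 \<alpha> u - res1 \<alpha> v" "u - v"]
    by (simp add: power2_eq_square)
  then show ?thesis
    by (cases "norm (res1 \<alpha> u - res1 \<alpha> v) = 0") (auto simp: mult_le_cancel_left)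
qed

text \<open>The map is the identity minus a firmly nonexpansive one: the cross term in the expanded
  square outweighs the square of \<open>d\<close>.\<close>

lemma A_X1_nonexpansive:
  assumes "\<alpha> \<in> {0<..<\<alpha>max}"
  shows "norm (A (X1 \<alpha> u) - A (X1 \<alpha> v)) \<le> norm (u - v)"
proof (rule power2_le_imp_le)
  define d where "d = res1 \<alpha> u - res1 \<alpha> v"
  have "A (X1 \<alpha> u) - A (X1 \<alpha> v) = (u - v) - d" by (simp add: A_X1 d_def)
  then have "(norm (A (X1 \<alpha> u) - A (X1 \<alpha> v)))\<^sup>2
      = (norm (u - v))\<^sup>2 - 2 * (d \<bullet> (u - v)) + (norm d)\<^sup>2"
    by (simp only: power2_norm_eq_inner) (simp add: inner_diff inner_commute)
  then show "(norm (A (X1 \<alpha> u) - A (X1 \<alpha> v)))\<^sup>2 \<le> (norm (u - v))\<^sup>2"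
    using res1_firmly_nonexpansive[OF assms, of u v] zero_le_power2[of "norm d"]
    unfolding d_def[symmetric] by linarith
qed simp

lemma X2_tikhonov_min:
  assumes "\<alpha> \<in> {0<..<\<alpha>max}"
  shows "is_arg_min (tikhonov_fun A R \<alpha> (v + res1 \<alpha> v)) (\<lambda>_. True) (X2 \<alpha> v)"
proof -
  have "0 < \<alpha>" using assms by simp
  then obtain c where c: "\<forall>x. bregman_step_fun A R \<alpha> v (X1 \<alpha> v) x =
      tikhonov_fun A R \<alpha> (v + res1 \<alpha> v) x + ereal c"
    using bregman_step_fun_eq_tikhonov_fun[of \<alpha> R "X1 \<alpha> v" A v]
      range_subgradient_finite[OF X1_subgradient[OF assms, of v]]
    unfolding res1_def by blast
  have "tikhonov_fun A R \<alpha> (v + res1 \<alpha> v) (X2 \<alpha> v) \<le> tikhonov_fun A R \<alpha> (v + res1 \<alpha> v) z" for z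
  proof -
    have "bregman_step_fun A R \<alpha> v (X1 \<alpha> v) (X2 \<alpha> v) \<le> bregman_step_fun A R \<alpha> v (X1 \<alpha> v) z"
      using X2_min[OF assms, of v] unfolding is_arg_min_linorder by blast
    then show ?thesis
      unfolding c[rule_format] by (simp add: ereal_add_le_add_iff2)
  qed
  then show ?thesis by (simp add: is_arg_min_linorder)
qed

lemma X2_subgradient:
  assumes "\<alpha> \<in> {0<..<\<alpha>max}"
  shows "range_subgradient A R (X2 \<alpha> v) ((1 / \<alpha>) *\<^sub>R (res1 \<alpha> v + res2 \<alpha> v))"
  using tikhonov_min_range_subgradient[OF R_convex R_proper _ X2_tikhonov_min[OF assms, of v]] assms
  by (simp add: A_X2 add.commute)

text \<open>\<open>X2 \<alpha> v\<close> satisfies the optimality condition for the data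
  \<open>v + res1 \<alpha> v\<close>, where its residual is
  \<open>res1 \<alpha> v + res2 \<alpha> v\<close>. This expresses the second residual through
  \<open>res1\<close> alone, so its estimates follow from nonexpansiveness.\<close>

lemma res2_eq:
  assumes "\<alpha> \<in> {0<..<\<alpha>max}"
  shows "res2 \<alpha> v = res1 \<alpha> (v + res1 \<alpha> v) - res1 \<alpha> v"
  using X1_unique(1)[OF assms X2_subgradient[OF assms, of v]] assms
  by (simp add: A_X2 algebra_simps)

text \<open>Firm nonexpansiveness between the data \<open>v + res1 \<alpha> v\<close> and
  \<open>v\<close>. The right-hand side is \<alpha> times the Hanke-Raus functional.\<close>

lemma norm_res2_sq_le:
  assumes "\<alpha> \<in> {0<..<\<alpha>max}"
  shows "(norm (res2 \<alpha> v))\<^sup>2 \<le> res2 \<alpha> v \<bullet> res1 \<alpha> v"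
  using res1_firmly_nonexpansive[OF assms, of "v + res1 \<alpha> v" v] by (simp add: res2_eq[OF assms])

lemma norm_res2_le:
  assumes "\<alpha> \<in> {0<..<\<alpha>max}"
  shows "norm (res2 \<alpha> v) \<le> norm (res1 \<alpha> v)"
  using res1_nonexpansive[OF assms, of "v + res1 \<alpha> v" v] by (simp add: res2_eq[OF assms])

text \<open>The map \<open>res1\<close> is applied once to \<open>v\<close> and once to
  \<open>v + res1 \<alpha> v\<close>; these contribute 1 and 2 to the constant.\<close>

lemma res2_lipschitz:
  assumes "\<alpha> \<in> {0<..<\<alpha>max}"
  shows "norm (res2 \<alpha> u - res2 \<alpha> v) \<le> 3 * norm (u - v)"
proof -
  define a b where "a = res1 \<alpha> (u + res1 \<alpha> u) - res1 \<alpha> (v + res1 \<alpha> v)" and "b = res1 \<alpha> u - res1 \<alpha> v"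
  have "norm a \<le> norm ((u - v) + b)"
    unfolding a_def b_def using res1_nonexpansive[OF assms, of "u + res1 \<alpha> u" "v + res1 \<alpha> v"]
    by (simp add: algebra_simps)
  also have "\<dots> \<le> norm (u - v) + norm b" by (rule norm_triangle_ineq)
  finally have "norm (a - b) \<le> norm (u - v) + 2 * norm b"
    using norm_triangle_ineq4[of a b] by simp
  moreover have "norm b \<le> norm (u - v)"
    unfolding b_def by (rule res1_nonexpansive[OF assms])
  moreover have "res2 \<alpha> u - res2 \<alpha> v = a - b" by (simp add: res2_eq[OF assms] a_def b_def)
  ultimately show ?thesis by simp
qed

text \<open>For exact data \<open>A (X1 \<alpha> (A x)) - A x\<close> equals minus the residual, so
  monotonicity against the source element \<open>w\<close> bounds the squared residual by \<alpha>
  times its inner product with \<open>w\<close>.\<close>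

lemma norm_res1_le:
  assumes "\<alpha> \<in> {0<..<\<alpha>max}" "range_subgradient A R x w"
  shows "norm (res1 \<alpha> (A x)) \<le> \<alpha> * norm w"
proof -
  have "norm (res1 \<alpha> (A x)) \<le> norm (\<alpha> *\<^sub>R w)"
  proof -
    define p where "p = res1 \<alpha> (A x)"
    have "0 \<le> (A (X1 \<alpha> (A x)) - A x) \<bullet> ((1/\<alpha>) *\<^sub>R p - w)"
      unfolding p_def by (intro range_subgradient_monotone[of _ R] X1_subgradient assms)
    then have "p \<bullet> p \<le> \<alpha> * (p \<bullet> w)"
      using assms(1) by (simp add: A_X1 p_def[symmetric] inner_diff_right field_simps)
    also have "\<dots> \<le> norm p * norm (\<alpha> *\<^sub>R w)"
      using norm_cauchy_schwarz[of p "\<alpha> *\<^sub>R w"] by simp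
    finally show ?thesis unfolding p_def[symmetric]
      by (cases "p = 0") (auto simp: power2_norm_eq_inner[symmetric] power2_eq_square)
  qed
  then show ?thesis using assms(1) by simp
qed


section \<open>Exact data: a small second residual forces a small first one\<close>

text \<open>Let \<open>q \<beta>\<close> be the first residual divided by \<beta>, a subgradient at
  \<open>X1 \<beta> y\<close>. For each small \<beta> the sequence \<open>q (\<alpha> k)\<close>
  converges to \<open>q \<beta>\<close>; as limits are unique, \<open>q\<close> is constant near
  0.\<close>

lemma res1_eventually_linear_of_res2_tendsto_0:
  assumes w: "range_subgradient A R x w"
    and \<alpha>: "\<And>k. \<alpha> k \<in> {0<..<\<alpha>max}"
    and lim: "(\<lambda>k::nat. res2 (\<alpha> k) (A x)) \<longlonglongrightarrow> 0"
    and "0 < \<epsilon>" and far: "\<And>k. \<epsilon> \<le> norm (res1 (\<alpha> k) (A x))"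
  obtains \<alpha>0 q where "0 < \<alpha>0" "\<alpha>0 \<le> \<alpha>max" "q \<noteq> 0"
    "\<And>\<beta>. \<beta> \<in> {0<..<\<alpha>0} \<Longrightarrow> res1 \<beta> (A x) = \<beta> *\<^sub>R q"
proof -
  define y where "y = A x"
  define q where "q = (\<lambda>\<beta>. (1 / \<beta>) *\<^sub>R res1 \<beta> y)"
  define e where "e = (\<lambda>k. res2 (\<alpha> k) y)"
  have res1_q: "res1 \<beta> y = \<beta> *\<^sub>R q \<beta>" if "\<beta> \<in> {0<..<\<alpha>max}" for \<beta>
    using that by (simp add: q_def)
  have q_le: "norm (q \<beta>) \<le> norm w" if "\<beta> \<in> {0<..<\<alpha>max}" for \<beta>
    using norm_res1_le[OF that w] that by (simp add: q_def y_def field_simps)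
  have le: "\<epsilon> \<le> \<alpha> k * norm w" for k
    using far[of k] norm_res1_le[OF \<alpha> w, of k] by simp
  have "norm w \<noteq> 0" using le[of 0] \<open>0 < \<epsilon>\<close> by auto
  then have "0 < norm w" by simp
  have \<alpha>_ge: "\<epsilon> / norm w \<le> \<alpha> k" for k
    using le[of k] \<open>0 < norm w\<close> by (simp add: pos_divide_le_eq)
  \<comment> \<open>Residuals of norm at least \<epsilon> keep every \<open>\<alpha> k\<close> above
    this threshold, so any \<beta> below it is smaller than the whole sequence.\<close>
  define \<alpha>0 where "\<alpha>0 = \<epsilon> / norm w"
  have "0 < \<alpha>0" using \<open>0 < \<epsilon>\<close> \<open>0 < norm w\<close> by (simp add: \<alpha>0_def)
  have "\<alpha>0 \<le> \<alpha>max" using \<alpha>_ge[of 0] \<alpha>[of 0] by (simp add: \<alpha>0_def)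
  have q_lim: "(\<lambda>k. q (\<alpha> k)) \<longlonglongrightarrow> q \<beta>" if \<beta>: "\<beta> \<in> {0<..<\<alpha>0}" for \<beta>
  proof -
    have \<beta>': "\<beta> \<in> {0<..<\<alpha>max}" using \<beta> \<open>\<alpha>0 \<le> \<alpha>max\<close> by auto
    have "(norm (q (\<alpha> k) - q \<beta>))\<^sup>2 \<le> 3 * norm w * norm (e k) / \<beta>" for k
    proof -
      define a where "a = \<alpha> k"
      define d where "d = q \<beta> - q a"
      have a: "a \<in> {0<..<\<alpha>max}" "0 < a" using \<alpha>[of k] by (auto simp: a_def)
      have "\<beta> < a" using \<beta> \<alpha>_ge[of k] by (simp add: \<alpha>0_def a_def)
      \<comment> \<open>Comparing first iterates controls the square of \<open>d\<close> by
        \<open>q \<beta> \<bullet> d\<close>. Comparing with the second iterate at \<open>a\<close>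
        then bounds that product by a multiple of the norm of \<open>e k\<close>.\<close>
      have "0 \<le> (A (X1 \<beta> y) - A (X1 a y)) \<bullet> (q \<beta> - q a)"
        unfolding q_def by (intro range_subgradient_monotone[of _ R] X1_subgradient \<beta>' a)
      also have "A (X1 \<beta> y) - A (X1 a y) = (a - \<beta>) *\<^sub>R q \<beta> - a *\<^sub>R d"
        by (simp only: A_X1 res1_q[OF \<beta>'] res1_q[OF a(1)] d_def) (simp add: algebra_simps)
      finally have m1: "a * (d \<bullet> d) \<le> (a - \<beta>) * (q \<beta> \<bullet> d)"
        by (simp add: d_def[symmetric] inner_diff_left)
      have "0 \<le> (A (X1 \<beta> y) - A (X2 a y)) \<bullet> (q \<beta> - (1 / a) *\<^sub>R (res1 a y + res2 a y))"
        unfolding q_def by (intro range_subgradient_monotone[of _ R] X1_subgradient X2_subgradient \<beta>' a)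
      also have "A (X1 \<beta> y) - A (X2 a y) = e k - \<beta> *\<^sub>R q \<beta>"
        by (simp only: A_X1 A_X2 res1_q[OF \<beta>'] e_def a_def) simp
      also have "q \<beta> - (1 / a) *\<^sub>R (res1 a y + res2 a y) = d - (1 / a) *\<^sub>R e k"
        by (simp add: d_def q_def e_def a_def algebra_simps)
      finally have "\<beta> * (q \<beta> \<bullet> d) + (e k \<bullet> e k) / a \<le> e k \<bullet> d + \<beta> / a * (q \<beta> \<bullet> e k)"
        by (simp add: inner_diff inner_commute algebra_simps)
      moreover have "0 \<le> (e k \<bullet> e k) / a" using a by simp
      moreover have "e k \<bullet> d \<le> norm (e k) * (2 * norm w)"
      proof -
        have "norm d \<le> 2 * norm w"
          using norm_triangle_ineq4[of "q \<beta>" "q a"] q_le[OF \<beta>'] q_le[OF a(1)] by (simp add: d_def)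
        then show ?thesis
          using norm_cauchy_schwarz[of "e k" d] mult_left_mono[of "norm d" "2 * norm w" "norm (e k)"]
          by simp
      qed
      moreover have "\<beta> / a * (q \<beta> \<bullet> e k) \<le> 1 * (norm w * norm (e k))"
      proof -
        have "q \<beta> \<bullet> e k \<le> norm w * norm (e k)"
          using norm_cauchy_schwarz[of "q \<beta>" "e k"] mult_right_mono[OF q_le[OF \<beta>'], of "norm (e k)"]
          by simp
        then have "\<beta> / a * (q \<beta> \<bullet> e k) \<le> \<beta> / a * (norm w * norm (e k))"
          using \<beta> a by (intro mult_left_mono) auto
        also have "\<dots> \<le> 1 * (norm w * norm (e k))"
          using \<open>\<beta> < a\<close> a by (intro mult_right_mono) auto
        finally show ?thesis .
      qed
      \<comment> \<open>Two of the three units come from the bound on \<open>d\<close>, one from the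
        term with \<open>\<beta> / a\<close>, which is below 1.\<close>
      moreover have "3 * norm w * norm (e k) = norm (e k) * (2 * norm w) + 1 * (norm w * norm (e k))"
        by simp
      ultimately have "\<beta> * (q \<beta> \<bullet> d) \<le> 3 * norm w * norm (e k)" by linarith
      then have s: "q \<beta> \<bullet> d \<le> 3 * norm w * norm (e k) / \<beta>"
        using \<beta> by (simp add: field_simps)
      have "a * (d \<bullet> d) \<le> (a - \<beta>) * (3 * norm w * norm (e k) / \<beta>)"
        using mult_left_mono[OF s, of "a - \<beta>"] m1 \<open>\<beta> < a\<close> by linarith
      also have "\<dots> \<le> a * (3 * norm w * norm (e k) / \<beta>)"
        using \<beta> by (intro mult_right_mono) auto
      finally have "d \<bullet> d \<le> 3 * norm w * norm (e k) / \<beta>"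
        by (rule mult_left_le_imp_le) (rule a(2))
      then show ?thesis
        by (simp add: a_def[symmetric] d_def power2_norm_eq_inner inner_diff inner_commute algebra_simps)
    qed
    then have bound: "norm (q (\<alpha> k) - q \<beta>) \<le> sqrt (3 * norm w * norm (e k) / \<beta>)" for k
      by (rule real_le_rsqrt)
    have "(\<lambda>k. 3 * norm w * norm (e k)) \<longlonglongrightarrow> 0"
      using tendsto_mult_right_zero[OF tendsto_norm_zero[OF lim]] by (simp add: e_def y_def)
    then have "(\<lambda>k. 3 * norm w * norm (e k) / \<beta>) \<longlonglongrightarrow> 0"
      by (rule tendsto_divide_zero)
    then have "(\<lambda>k. sqrt (3 * norm w * norm (e k) / \<beta>)) \<longlonglongrightarrow> sqrt 0"
      by (rule tendsto_real_sqrt)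
    then have "(\<lambda>k. sqrt (3 * norm w * norm (e k) / \<beta>)) \<longlonglongrightarrow> 0"
      unfolding real_sqrt_zero .
    with always_eventually[OF allI[OF bound]] have "(\<lambda>k. q (\<alpha> k) - q \<beta>) \<longlonglongrightarrow> 0"
      by (rule Lim_null_comparison)
    then show ?thesis by (simp add: LIM_zero_cancel)
  qed
  show thesis
  proof (rule that)
    show "0 < \<alpha>0" "\<alpha>0 \<le> \<alpha>max" by fact+
    show "res1 \<beta> (A x) = \<beta> *\<^sub>R q (\<alpha>0 / 2)" if \<beta>: "\<beta> \<in> {0<..<\<alpha>0}" for \<beta>
      using LIMSEQ_unique[OF q_lim[OF \<beta>] q_lim[of "\<alpha>0 / 2"]] res1_q[of \<beta>] \<beta> \<open>0 < \<alpha>0\<close>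
        \<open>\<alpha>0 \<le> \<alpha>max\<close>
      by (simp add: y_def)
    \<comment> \<open>This lower bound is uniform in \<open>k\<close> and survives the limit, so the
      common value of \<open>q\<close> is not 0.\<close>
    have "\<epsilon> / \<alpha>max \<le> norm (q (\<alpha> k))" for k
    proof -
      have "\<epsilon> \<le> \<alpha> k * norm (q (\<alpha> k))"
        using far[of k] \<alpha>[of k] by (simp add: q_def y_def)
      also have "\<dots> \<le> \<alpha>max * norm (q (\<alpha> k))"
        using \<alpha>[of k] by (intro mult_right_mono) auto
      finally show ?thesis using \<alpha>[of k] by (simp add: field_simps)
    qed
    then have "\<epsilon> / \<alpha>max \<le> norm (q (\<alpha>0 / 2))"
      using \<open>0 < \<alpha>0\<close> by (intro tendsto_lowerbound[OF tendsto_norm[OF q_lim]]) auto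
    moreover have "0 < \<epsilon> / \<alpha>max"
      using \<open>0 < \<epsilon>\<close> \<alpha>[of 0] by auto
    ultimately show "q (\<alpha>0 / 2) \<noteq> 0" by auto
  qed
qed

text \<open>Take \<open>u\<close> almost minimising \<open>R\<close> and solve the Tikhonov problem
  with data \<open>A u\<close>. Comparison with \<open>u\<close>, which has residual 0, bounds half
  the squared residual by \<alpha> times the gap \<open>t\<close>.\<close>

lemma exists_small_range_subgradient:
  assumes "0 < \<alpha>max" and bdd: "\<And>z. ereal b \<le> R z" and "0 < \<eta>"
  obtains x r where "range_subgradient A R x r" "norm r \<le> \<eta>"
proof -
  define \<alpha> where "\<alpha> = \<alpha>max / 2"
  have \<alpha>: "\<alpha> \<in> {0<..<\<alpha>max}" "0 < \<alpha>" using assms(1) by (auto simp: \<alpha>_def)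
  define S where "S = {c. \<exists>u. R u = ereal c}"
  obtain u0 where "R u0 \<noteq> \<infinity>" "R u0 \<noteq> -\<infinity>" using R_proper by (auto simp: proper_fun_def)
  then have "real_of_ereal (R u0) \<in> S"
    by (auto simp: S_def ereal_real intro!: exI[of _ u0])
  then have "S \<noteq> {}" by blast
  have "b \<le> c" if "c \<in> S" for c
    using that bdd by (auto simp: S_def) (metis ereal_less_eq(3))
  then have "bdd_below S" by (intro bdd_belowI)
  \<comment> \<open>Chosen so that the squared residual is at most
    \<open>(\<alpha> * \<eta>)\<close> squared; division by \<alpha> then leaves \<eta>.\<close>
  define t where "t = \<alpha> * \<eta>\<^sup>2 / 2"
  have "Inf S < Inf S + t" using \<alpha> \<open>0 < \<eta>\<close> by (simp add: t_def)
  then obtain c where c: "c \<in> S" "c < Inf S + t" using cInf_lessD[OF \<open>S \<noteq> {}\<close>] by blast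
  then obtain u where u: "R u = ereal c" by (auto simp: S_def)
  define x where "x = X1 \<alpha> (A u)"
  define p where "p = res1 \<alpha> (A u)"
  have sub: "range_subgradient A R x ((1 / \<alpha>) *\<^sub>R p)"
    unfolding x_def p_def by (rule X1_subgradient[OF \<alpha>(1)])
  define c' where "c' = real_of_ereal (R x)"
  have c': "R x = ereal c'"
    using range_subgradient_finite[OF sub] by (simp add: c'_def ereal_real)
  then have "Inf S \<le> c'" using \<open>bdd_below S\<close> by (auto intro!: cInf_lower simp: S_def)
  have "tikhonov_fun A R \<alpha> (A u) x \<le> tikhonov_fun A R \<alpha> (A u) u"
    using X1_min[OF \<alpha>(1), of "A u"] by (auto simp: is_arg_min_linorder x_def)
  then have "1/2 * (norm p)\<^sup>2 + \<alpha> * c' \<le> \<alpha> * c"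
    using A_X1[of \<alpha> "A u"] by (simp add: tikhonov_fun_def c' u x_def[symmetric] p_def[symmetric])
  moreover have "\<alpha> * c \<le> \<alpha> * (c' + t)"
    using c \<open>Inf S \<le> c'\<close> \<alpha> by (intro mult_left_mono) auto
  moreover have "2 * (\<alpha> * t) = (\<alpha> * \<eta>)\<^sup>2"
    by (simp add: t_def power2_eq_square)
  ultimately have "(norm p)\<^sup>2 \<le> (\<alpha> * \<eta>)\<^sup>2"
    unfolding distrib_left by linarith
  then have "norm p \<le> \<alpha> * \<eta>"
    by (rule power2_le_imp_le) (use \<alpha> \<open>0 < \<eta>\<close> in simp)
  then have "norm ((1 / \<alpha>) *\<^sub>R p) \<le> \<eta>"
    using \<alpha> by (simp add: field_simps)
  then show thesis using that sub by blast
qed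

lemma bregman_dist_X1:
  assumes \<alpha>: "\<alpha> \<in> {0<..<\<alpha>max}"
  shows "bregman_dist R (tikhonov_subgrad A \<alpha> y (X1 \<alpha> y)) (X1 \<alpha> v) (X1 \<alpha> y) =
    ereal (real_of_ereal (R (X1 \<alpha> v)) - real_of_ereal (R (X1 \<alpha> y))
      - (1 / \<alpha>) *\<^sub>R res1 \<alpha> y \<bullet> (A (X1 \<alpha> v) - A (X1 \<alpha> y)))"
proof -
  have "\<bar>R (X1 \<alpha> u)\<bar> \<noteq> \<infinity>" for u
    by (rule range_subgradient_finite[OF X1_subgradient[OF \<alpha>]])
  then have "R (X1 \<alpha> u) = ereal (real_of_ereal (R (X1 \<alpha> u)))" for u
    by (simp add: ereal_real)
  then obtain a b where "R (X1 \<alpha> v) = ereal a" "R (X1 \<alpha> y) = ereal b"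
    by blast
  then show ?thesis
    by (simp add: bregman_dist_def tikhonov_subgrad_def res1_def residual_def dual_adjoint_apply
        blinfun.bilinear_simps algebra_simps inner_diff diff_divide_distrib)
qed


section \<open>Exclusion of first residuals that are linear in the parameter\<close>

lemma res1_not_linear:
  assumes "0 < \<alpha>0" "\<alpha>0 \<le> \<alpha>max"
    and lin: "\<And>\<alpha>. \<alpha> \<in> {0<..<\<alpha>0} \<Longrightarrow> res1 \<alpha> y = \<alpha> *\<^sub>R q"
    and bdd: "\<And>z. ereal b \<le> R z"
    and "0 < C"
    and auto_reg: "\<And>\<alpha> v. \<alpha> \<in> {0<..<\<alpha>max} \<Longrightarrow>
          bregman_dist R (tikhonov_subgrad A \<alpha> y (X1 \<alpha> y)) (X1 \<alpha> v) (X1 \<alpha> y)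
            \<le> ereal (C * (1 / \<alpha>) * ((res2 \<alpha> v - res2 \<alpha> y) \<bullet> (res1 \<alpha> v - res1 \<alpha> y)))"
  shows "q = 0"
proof (rule ccontr)
  assume "q \<noteq> 0"
  define \<rho> where "\<rho> = (\<lambda>x. real_of_ereal (R x))"
  have in_max: "\<alpha> \<in> {0<..<\<alpha>max}" if "\<alpha> \<in> {0<..<\<alpha>0}" for \<alpha>
    using that \<open>\<alpha>0 \<le> \<alpha>max\<close> by auto
  have AX1: "A (X1 \<alpha> y) = y - \<alpha> *\<^sub>R q" if "\<alpha> \<in> {0<..<\<alpha>0}" for \<alpha>
    using lin[OF that] by (simp add: A_X1)
  have sub: "range_subgradient A R (X1 \<alpha> y) q" if "\<alpha> \<in> {0<..<\<alpha>0}" for \<alpha>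
    using X1_subgradient[OF in_max[OF that], of y] lin[OF that] that by simp

  \<comment> \<open>The vector \<open>q\<close> is a subgradient at points whose images
    \<open>y - \<beta> *\<^sub>R q\<close> approach \<open>y\<close>. Monotonicity against the
    second iterate, with \<beta> tending to 0, leaves a nonpositive square of
    \<open>e\<close>.\<close>
  have res2_0: "res2 \<alpha> y = 0" if \<alpha>: "\<alpha> \<in> {0<..<\<alpha>0}" for \<alpha>
  proof -
    define e where "e = res2 \<alpha> y"
    have "e \<bullet> e \<le> \<beta> * (q \<bullet> e)" if "0 < \<beta>" "\<beta> < \<alpha>0" for \<beta>
    proof -
      have \<beta>: "\<beta> \<in> {0<..<\<alpha>0}" using that by simp
      have "0 \<le> (A (X1 \<beta> y) - A (X2 \<alpha> y)) \<bullet> (q - (1 / \<alpha>) *\<^sub>R (res1 \<alpha> y + res2 \<alpha> y))"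
        by (intro range_subgradient_monotone[of _ R] sub[OF \<beta>] X2_subgradient in_max \<alpha>)
      also have "A (X1 \<beta> y) - A (X2 \<alpha> y) = e - \<beta> *\<^sub>R q"
        by (simp add: AX1[OF \<beta>] A_X2 e_def)
      also have "q - (1 / \<alpha>) *\<^sub>R (res1 \<alpha> y + res2 \<alpha> y) = - (1 / \<alpha>) *\<^sub>R e"
        using \<alpha> by (simp add: lin[OF \<alpha>] e_def scaleR_add_right)
      finally have "(e \<bullet> e - \<beta> * (q \<bullet> e)) / \<alpha> \<le> 0"
        by (simp add: inner_diff_left)
      then show ?thesis using \<alpha> by (simp add: divide_le_0_iff)
    qed
    then have "e \<bullet> e \<le> 0" by (rule nonpos_of_le_mult_small[OF \<open>0 < \<alpha>0\<close>])
    then show ?thesis by (simp add: e_def flip: power2_norm_eq_inner)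
  qed
  define \<gamma> where "\<gamma> = \<alpha>0 / 2"
  have \<gamma>: "\<gamma> \<in> {0<..<\<alpha>0}" "0 < \<gamma>" using \<open>0 < \<alpha>0\<close> by (auto simp: \<gamma>_def)
  \<comment> \<open>The points \<open>X1 \<alpha> y\<close> share the subgradient \<open>q\<close>,
    so \<open>R\<close> is affine along their images; \<kappa> is its value extrapolated to the
    image \<open>y\<close>. Hence \<open>above\<close> is an affine minorant of
    \<open>R\<close>.\<close>
  define \<kappa> where "\<kappa> = \<rho> (X1 \<gamma> y) + \<gamma> * (q \<bullet> q)"
  have \<kappa>: "\<rho> (X1 \<alpha> y) + \<alpha> * (q \<bullet> q) = \<kappa>" if \<alpha>: "\<alpha> \<in> {0<..<\<alpha>0}" for \<alpha>
  proof -
    have "\<rho> (X1 \<alpha> y) + q \<bullet> (A (X1 \<gamma> y) - A (X1 \<alpha> y)) \<le> \<rho> (X1 \<gamma> y)"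
      "\<rho> (X1 \<gamma> y) + q \<bullet> (A (X1 \<alpha> y) - A (X1 \<gamma> y)) \<le> \<rho> (X1 \<alpha> y)"
      unfolding \<rho>_def
      using range_subgradient_real_ineq[OF sub[OF \<alpha>] range_subgradient_finite[OF sub[OF \<gamma>(1)]]]
        range_subgradient_real_ineq[OF sub[OF \<gamma>(1)] range_subgradient_finite[OF sub[OF \<alpha>]]]
      by this+
    then show ?thesis
      unfolding AX1[OF \<alpha>] AX1[OF \<gamma>(1)] \<kappa>_def by (simp add: inner_diff)
  qed
  have above: "\<kappa> + q \<bullet> (A z - y) \<le> \<rho> z" if "\<bar>R z\<bar> \<noteq> \<infinity>" for z
    using range_subgradient_real_ineq[OF sub[OF \<gamma>(1)] that] AX1[OF \<gamma>(1)]
    by (simp add: \<kappa>_def \<rho>_def inner_diff inner_add)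

  \<comment> \<open>The data \<open>A x + \<alpha> *\<^sub>R r\<close> give first residual
    \<open>\<alpha> *\<^sub>R r\<close>, so the condition can be tested at any pair
    \<open>(x, r)\<close>. The Bregman distance becomes the excess of \<open>R\<close> over the
    minorant, and the factor \<open>1 / \<alpha>\<close> cancels.\<close>
  have auto_reg': "\<rho> x - \<kappa> - q \<bullet> (A x - y) \<le> C * (res2 \<alpha> (A x + \<alpha> *\<^sub>R r) \<bullet> (r - q))"
    if \<alpha>: "\<alpha> \<in> {0<..<\<alpha>0}" and r: "range_subgradient A R x r" for \<alpha> x r
  proof -
    define v where "v = A x + \<alpha> *\<^sub>R r"
    note uniq = X1_unique[OF in_max[OF \<alpha>] r, folded v_def]
    have AX: "A (X1 \<alpha> v) = A x" using uniq(1) by (simp add: A_X1) (simp add: v_def)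
    have "\<rho> x - \<rho> (X1 \<alpha> y) - q \<bullet> (A x - (y - \<alpha> *\<^sub>R q))
        \<le> C * (1 / \<alpha>) * (res2 \<alpha> v \<bullet> (\<alpha> *\<^sub>R (r - q)))"
      using auto_reg[OF in_max[OF \<alpha>], of v] \<alpha>
      unfolding bregman_dist_X1[OF in_max[OF \<alpha>]] res2_0[OF \<alpha>] lin[OF \<alpha>] uniq AX AX1[OF \<alpha>]
      by (simp add: \<rho>_def scaleR_diff_right)
    also have "\<dots> = C * (res2 \<alpha> v \<bullet> (r - q))" using \<alpha> by simp
    finally show ?thesis
      using \<kappa>[OF \<alpha>] by (simp add: v_def inner_diff inner_add)
  qed

  text \<open>The right-hand side of \<open>auto_reg'\<close> is \<open>O(\<alpha>)\<close> while its left-hand side does not depend on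
    \<open>\<alpha>\<close>.\<close>
  have affine: "\<rho> x = \<kappa> + q \<bullet> (A x - y)" if r: "range_subgradient A R x r" for x r
  proof -
    have "\<rho> x - \<kappa> - q \<bullet> (A x - y) \<le> \<alpha> * (C * norm r * norm (r - q))"
      if "0 < \<alpha>" "\<alpha> < \<alpha>0" for \<alpha>
    proof -
      have \<alpha>: "\<alpha> \<in> {0<..<\<alpha>0}" using that by simp
      let ?p2 = "res2 \<alpha> (A x + \<alpha> *\<^sub>R r)"
      have "norm ?p2 \<le> \<alpha> * norm r"
        using norm_res2_le[OF in_max[OF \<alpha>], of "A x + \<alpha> *\<^sub>R r"] X1_unique(1)[OF in_max[OF \<alpha>] r] that
        by simp
      then have "?p2 \<bullet> (r - q) \<le> \<alpha> * norm r * norm (r - q)"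
        using norm_cauchy_schwarz[of ?p2 "r - q"]
          mult_right_mono[of "norm ?p2" "\<alpha> * norm r" "norm (r - q)"] by simp
      then have "C * (?p2 \<bullet> (r - q)) \<le> C * (\<alpha> * norm r * norm (r - q))"
        using \<open>0 < C\<close> by simp
      then show ?thesis using auto_reg'[OF \<alpha> r] by (simp add: mult_ac)
    qed
    then have "\<rho> x - \<kappa> - q \<bullet> (A x - y) \<le> 0"
      by (rule nonpos_of_le_mult_small[OF \<open>0 < \<alpha>0\<close>])
    then show ?thesis using above[OF range_subgradient_finite[OF r]] by simp
  qed

  \<comment> \<open>Any fraction of \<open>norm q\<close> below one third suffices, since the end of
    the proof yields \<open>norm q \<le> 3 * norm r\<close>.\<close>
  have "0 < \<alpha>max" "0 < norm q / 4" using \<open>0 < \<alpha>0\<close> \<open>\<alpha>0 \<le> \<alpha>max\<close> \<open>q \<noteq> 0\<close> by simp_all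
  then obtain x r where r: "range_subgradient A R x r" and r_small: "norm r \<le> norm q / 4"
    using exists_small_range_subgradient[OF _ bdd] by blast
  have Rx: "R x = ereal (\<rho> x)"
    using range_subgradient_finite[OF r] by (simp add: \<rho>_def ereal_real)
  \<comment> \<open>At \<open>x\<close> the affine minorant is attained, so \<open>q\<close> is a
    subgradient there besides \<open>r\<close>, and so are their convex combinations.\<close>
  have sub_between: "range_subgradient A R x ((1 - t) *\<^sub>R r + t *\<^sub>R q)" if t: "0 \<le> t" "t \<le> 1" for t
  proof (rule range_subgradientI)
    show "\<bar>R x\<bar> \<noteq> \<infinity>" by (simp add: Rx)
    fix z
    show "R x + ereal (((1 - t) *\<^sub>R r + t *\<^sub>R q) \<bullet> (A z - A x)) \<le> R z"
    proof (cases "R z = \<infinity>")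
      case False
      then have fin: "\<bar>R z\<bar> \<noteq> \<infinity>" using R_proper by (auto simp: proper_fun_def)
      define d where "d = A z - A x"
      have "\<rho> x + r \<bullet> d \<le> \<rho> z"
        using range_subgradient_real_ineq[OF r fin] by (simp add: \<rho>_def d_def)
      moreover have "\<rho> x + q \<bullet> d \<le> \<rho> z"
        using above[OF fin] affine[OF r] by (simp add: d_def inner_diff)
      ultimately have "(1 - t) * (\<rho> x + r \<bullet> d) + t * (\<rho> x + q \<bullet> d) \<le> \<rho> z"
        using t by (intro convex_bound_le) auto
      moreover have "(1 - t) * (\<rho> x + r \<bullet> d) + t * (\<rho> x + q \<bullet> d)
          = \<rho> x + ((1 - t) *\<^sub>R r + t *\<^sub>R q) \<bullet> d"
        by (simp add: inner_add_left distrib_left left_diff_distrib)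
      moreover have "R z = ereal (\<rho> z)" using fin by (simp add: \<rho>_def ereal_real)
      ultimately show ?thesis by (simp add: Rx d_def)
    qed simp
  qed
  define n where "n = q - r"
  define m where "m = (1/2) *\<^sub>R (r + q)"
  \<comment> \<open>For data \<open>A x + \<gamma> *\<^sub>R m\<close> the first residual is
    \<open>\<gamma> *\<^sub>R m\<close>; adding it back gives
    \<open>A x + \<gamma> *\<^sub>R (r + q)\<close>. These data differ by
    \<open>\<gamma> *\<^sub>R r\<close> from data with residual \<open>\<gamma> *\<^sub>R q\<close>,
    so \<open>a\<close> is small and the second residual is nearly
    \<open>(\<gamma> / 2) *\<^sub>R n\<close>.\<close>
  define a where "a = res1 \<gamma> (A x + \<gamma> *\<^sub>R (r + q)) - \<gamma> *\<^sub>R q"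
  have m: "range_subgradient A R x m" and q: "range_subgradient A R x q"
    using sub_between[of "1/2"] sub_between[of 1] by (simp_all add: m_def scaleR_add_right)
  have "norm a \<le> \<gamma> * norm r"
    using res1_nonexpansive[OF in_max[OF \<gamma>(1)], of "A x + \<gamma> *\<^sub>R (r + q)" "A x + \<gamma> *\<^sub>R q"] \<gamma>
      X1_unique(1)[OF in_max[OF \<gamma>(1)] q]
    by (simp add: a_def scaleR_add_right)
  have m2: "m + m = r + q" by (simp add: m_def flip: scaleR_add_left)
  have "res2 \<gamma> (A x + \<gamma> *\<^sub>R m) = a + \<gamma> *\<^sub>R (q - m)"
    using res2_eq[OF in_max[OF \<gamma>(1)], of "A x + \<gamma> *\<^sub>R m"] X1_unique(1)[OF in_max[OF \<gamma>(1)] m]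
    by (simp add: a_def scaleR_diff_right add.assoc m2 flip: scaleR_add_right)
  moreover have qm: "q - m = (1/2) *\<^sub>R n"
    by (simp add: m_def n_def algebra_simps flip: scaleR_add_left)
  moreover have "m - q = - (1/2) *\<^sub>R n"
    using qm by (metis minus_diff_eq scaleR_minus_left)
  \<comment> \<open>By \<open>affine\<close> the excess at \<open>x\<close> is 0, so the product on
    the right cannot be negative. But the second residual points nearly opposite to
    \<open>m - q\<close> unless \<open>n\<close> is small.\<close>
  moreover have "0 \<le> C * (res2 \<gamma> (A x + \<gamma> *\<^sub>R m) \<bullet> (m - q))"
    using auto_reg'[OF \<gamma>(1) m] affine[OF r] by simp
  ultimately have "0 \<le> (a + (\<gamma> / 2) *\<^sub>R n) \<bullet> (- (1/2) *\<^sub>R n)"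
    using \<open>0 < C\<close> by (simp add: zero_le_mult_iff mult_le_0_iff)
  then have "\<gamma> * (norm n)\<^sup>2 \<le> 2 * (- (a \<bullet> n))"
    by (simp add: inner_add_left power2_norm_eq_inner)
  also have "- (a \<bullet> n) \<le> norm a * norm n"
    using norm_cauchy_schwarz[of "- a" n] by simp
  also have "\<dots> \<le> \<gamma> * norm r * norm n"
    using \<open>norm a \<le> \<gamma> * norm r\<close> by (rule mult_right_mono) simp
  finally have "\<gamma> * norm n * norm n \<le> \<gamma> * norm n * (2 * norm r)"
    by (simp add: power2_eq_square mult_ac)
  moreover have "norm q \<le> norm n + norm r"
    using norm_triangle_ineq[of n r] by (simp add: n_def)
  then have "0 < norm n" using r_small \<open>0 < norm q / 4\<close> by linarith
  ultimately have "norm n \<le> 2 * norm r"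
    using \<gamma>(2) by (simp add: mult_le_cancel_left)
  then show False
    using \<open>norm q \<le> norm n + norm r\<close> r_small \<open>0 < norm q / 4\<close> by linarith
qed

text \<open>A violation for every \<eta> would produce a sequence of the kind just excluded. The
  threshold is uniform in \<alpha>, so it can be used along \<open>\<alpha>star \<delta>\<close>
  whatever the limiting behaviour of these parameters.\<close>

lemma res1_small_of_res2_small:
  assumes w: "range_subgradient A R x w"
    and bdd: "\<And>z. ereal b \<le> R z"
    and "0 < C"
    and auto_reg: "\<And>\<alpha> v. \<alpha> \<in> {0<..<\<alpha>max} \<Longrightarrow>
          bregman_dist R (tikhonov_subgrad A \<alpha> (A x) (X1 \<alpha> (A x))) (X1 \<alpha> v) (X1 \<alpha> (A x))
            \<le> ereal (C * (1 / \<alpha>) * ((res2 \<alpha> v - res2 \<alpha> (A x)) \<bullet> (res1 \<alpha> v - res1 \<alpha> (A x))))"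
    and "0 < \<epsilon>"
  obtains \<eta> where "0 < \<eta>"
    "\<And>\<alpha>. \<alpha> \<in> {0<..<\<alpha>max} \<Longrightarrow> norm (res2 \<alpha> (A x)) < \<eta> \<Longrightarrow> norm (res1 \<alpha> (A x)) < \<epsilon>"
proof (rule ccontr)
  assume "\<not> thesis"
  then have "\<forall>k. \<exists>\<alpha>\<in>{0<..<\<alpha>max}. norm (res2 \<alpha> (A x)) < inverse (real (Suc k)) \<and> \<epsilon> \<le> norm (res1 \<alpha> (A x))"
    using that by (metis inverse_positive_iff_positive not_less of_nat_0_less_iff zero_less_Suc)
  then obtain \<alpha> where \<alpha>: "\<And>k. \<alpha> k \<in> {0<..<\<alpha>max}"
    and small: "\<And>k. norm (res2 (\<alpha> k) (A x)) < inverse (real (Suc k))"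
    and far: "\<And>k. \<epsilon> \<le> norm (res1 (\<alpha> k) (A x))"
    by metis
  have "(\<lambda>k. res2 (\<alpha> k) (A x)) \<longlonglongrightarrow> 0"
    by (rule Lim_null_comparison[OF _ LIMSEQ_inverse_real_of_nat])
      (use small in \<open>auto intro!: always_eventually less_imp_le\<close>)
  then obtain \<alpha>0 q where "0 < \<alpha>0" "\<alpha>0 \<le> \<alpha>max" "q \<noteq> 0"
    "\<And>\<beta>. \<beta> \<in> {0<..<\<alpha>0} \<Longrightarrow> res1 \<beta> (A x) = \<beta> *\<^sub>R q"
    using res1_eventually_linear_of_res2_tendsto_0[where \<alpha> = \<alpha>, OF w \<alpha> _ \<open>0 < \<epsilon>\<close> far] by blast
  then show False
    using res1_not_linear[OF _ _ _ bdd \<open>0 < C\<close> auto_reg] by blast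
qed

end

text \<open>Outside a ball coercivity makes \<open>R\<close> positive; inside it the subgradient
  inequality at \<open>x\<close> gives an affine lower bound, which is bounded on the ball.\<close>

lemma coercive_subgradient_bounded_below:
  fixes A :: "'x::real_normed_vector \<Rightarrow>\<^sub>L 'y::real_inner"
  assumes "coercive R" and w: "range_subgradient A R x w"
  obtains b where "\<And>z. ereal b \<le> R z"
proof -
  have "\<forall>\<^sub>F z in at_infinity. 0 < R z"
    using assms(1) unfolding coercive_def by (rule order_tendstoD) simp
  then obtain B where B: "\<And>z. B \<le> norm z \<Longrightarrow> 0 < R z" by (auto simp: eventually_at_infinity)
  define c where "c = real_of_ereal (R x)"
  have c: "R x = ereal c" using range_subgradient_finite[OF w] by (simp add: c_def ereal_real)
  define b where "b = min 0 (c - norm w * (norm A * (\<bar>B\<bar> + norm x)))"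
  have "ereal b \<le> R z" for z
  proof (cases "B \<le> norm z")
    case True
    have "b \<le> 0" by (simp add: b_def)
    then have "ereal b \<le> 0" by simp
    also have "0 \<le> R z" using B[OF True] by simp
    finally show ?thesis .
  next
    case False
    have "norm (A (z - x)) \<le> norm A * norm (z - x)" by (rule norm_blinfun)
    also have "\<dots> \<le> norm A * (\<bar>B\<bar> + norm x)"
      using False norm_triangle_ineq4[of z x] by (intro mult_left_mono) auto
    finally have "norm w * norm (A (z - x)) \<le> norm w * (norm A * (\<bar>B\<bar> + norm x))"
      by (rule mult_left_mono) simp
    moreover have "- (w \<bullet> A (z - x)) \<le> norm w * norm (A (z - x))"
      using norm_cauchy_schwarz[of "- w" "A (z - x)"] by simp
    ultimately have "b \<le> c + w \<bullet> (A z - A x)" by (simp add: b_def blinfun.diff_right)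
    then have "ereal b \<le> R x + ereal (w \<bullet> (A z - A x))" by (simp add: c)
    then show ?thesis using range_subgradient_ineq[OF w, of z] by (rule order_trans)
  qed
  then show thesis by (rule that)
qed

section \<open>Convergence of the Hanke-Raus rule\<close>

theorem theorem3:
  fixes A :: "'x::banach \<Rightarrow>\<^sub>L 'y::{real_inner, complete_space}"
    and J :: "'x \<Rightarrow> ('z::banach \<Rightarrow>\<^sub>L real)"
    and R :: "'x \<Rightarrow> ereal"
    and \<alpha>max :: real
    and y w :: 'y
    and xdag :: 'x
    and \<xi> :: "'x \<Rightarrow>\<^sub>L real"
    and X1 X2 :: "real \<Rightarrow> 'y \<Rightarrow> 'x"
    and y\<delta> :: "real \<Rightarrow> 'y"
    and \<alpha>star :: "real \<Rightarrow> real"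
  assumes predual: "dual_identification J"
    and R_convex: "convex_fun R"
    and R_proper: "proper_fun R"
    and R_coercive: "coercive R"
    and R_lsc: "lsc_in (weak_star_topology J) R"
    and \<alpha>max_pos: "0 < \<alpha>max"
    and xdag_min: "is_arg_min R (\<lambda>x. A x = y) xdag"
    and X1_min: "\<And>\<alpha> v. \<alpha> \<in> {0<..<\<alpha>max} \<Longrightarrow>
          is_arg_min (tikhonov_fun A R \<alpha> v) (\<lambda>_. True) (X1 \<alpha> v)"
    and X2_min: "\<And>\<alpha> v. \<alpha> \<in> {0<..<\<alpha>max} \<Longrightarrow>
          is_arg_min (bregman_step_fun A R \<alpha> v (X1 \<alpha> v)) (\<lambda>_. True) (X2 \<alpha> v)"
    and source: "\<xi> = dual_adjoint A w" "\<xi> \<in> subdifferential R xdag"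
    and noise: "\<And>\<delta>. 0 < \<delta> \<Longrightarrow> norm (y\<delta> \<delta> - y) \<le> \<delta>"
    and \<alpha>star_min: "\<And>\<delta>. 0 < \<delta> \<Longrightarrow>
          is_arg_min (\<lambda>\<alpha>. hanke_raus A X1 X2 \<alpha> (y\<delta> \<delta>)) (\<lambda>\<alpha>. \<alpha> \<in> {0<..<\<alpha>max}) (\<alpha>star \<delta>)"
    and auto_reg: "\<exists>C>0. \<forall>\<alpha>\<in>{0<..<\<alpha>max}. \<forall>v.
          bregman_dist R (tikhonov_subgrad A \<alpha> y (X1 \<alpha> y)) (X1 \<alpha> v) (X1 \<alpha> y)
            \<le> ereal (C * (1 / \<alpha>) *
                ((residual A v (X2 \<alpha> v) - residual A y (X2 \<alpha> y)) \<bullet>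
                 (residual A v (X1 \<alpha> v) - residual A y (X1 \<alpha> y))))"
  shows "((\<lambda>\<delta>. bregman_dist R \<xi> (X1 (\<alpha>star \<delta>) (y\<delta> \<delta>)) xdag) \<longlongrightarrow> 0) (at_right 0)"
proof -
  interpret bregman_iteration A R \<alpha>max X1 X2
    by unfold_locales fact+
  have y: "A xdag = y" using xdag_min by (simp add: is_arg_min_def)
  have w: "range_subgradient A R xdag w"
    using source by (simp add: range_subgradient_def)
  obtain C where "0 < C" and C: "\<And>\<alpha> v. \<alpha> \<in> {0<..<\<alpha>max} \<Longrightarrow>
      bregman_dist R (tikhonov_subgrad A \<alpha> y (X1 \<alpha> y)) (X1 \<alpha> v) (X1 \<alpha> y)
        \<le> ereal (C * (1 / \<alpha>) * ((res2 \<alpha> v - res2 \<alpha> y) \<bullet> (res1 \<alpha> v - res1 \<alpha> y)))"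
    using auto_reg unfolding res1_def res2_def by blast
  obtain b where b: "\<And>z. ereal b \<le> R z"
    using coercive_subgradient_bounded_below[OF R_coercive w] by blast
  have as: "\<alpha>star \<delta> \<in> {0<..<\<alpha>max}" if "0 < \<delta>" for \<delta>
    using \<alpha>star_min[OF that] by (simp add: is_arg_min_def)

  define p where "p = (\<lambda>\<delta>. res1 (\<alpha>star \<delta>) y)"
  define p\<delta> where "p\<delta> = (\<lambda>\<delta>. res1 (\<alpha>star \<delta>) (y\<delta> \<delta>))"
  define p2 where "p2 = (\<lambda>\<delta>. res2 (\<alpha>star \<delta>) y)"
  define p2\<delta> where "p2\<delta> = (\<lambda>\<delta>. res2 (\<alpha>star \<delta>) (y\<delta> \<delta>))"
  define \<psi> where "\<psi> = (\<lambda>\<delta>. 1 / \<alpha>star \<delta> * (p2\<delta> \<delta> \<bullet> p\<delta> \<delta>))"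

  have \<psi>_nonneg: "(norm (p2\<delta> \<delta>))\<^sup>2 \<le> \<alpha>max * \<psi> \<delta>" "0 \<le> \<psi> \<delta>" if "0 < \<delta>" for \<delta>
  proof -
    have le: "(norm (p2\<delta> \<delta>))\<^sup>2 \<le> \<alpha>star \<delta> * \<psi> \<delta>"
      using norm_res2_sq_le[OF as[OF that], of "y\<delta> \<delta>"] as[OF that] by (simp add: \<psi>_def p2\<delta>_def p\<delta>_def)
    then have "0 \<le> \<alpha>star \<delta> * \<psi> \<delta>" using zero_le_power2 order_trans by blast
    then show "0 \<le> \<psi> \<delta>" using as[OF that] by (simp add: zero_le_mult_iff)
    then show "(norm (p2\<delta> \<delta>))\<^sup>2 \<le> \<alpha>max * \<psi> \<delta>"
      using le as[OF that] mult_right_mono[of "\<alpha>star \<delta>" \<alpha>max "\<psi> \<delta>"] by simp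
  qed
  \<comment> \<open>Comparison with the admissible parameter \<delta>: both residuals there are at
    most \<open>\<delta> * (1 + norm w)\<close>, one part from the noise and one from the source
    condition. Dividing their product by \<delta> leaves order \<delta>.\<close>
  have \<psi>_le: "\<psi> \<delta> \<le> \<delta> * (1 + norm w)\<^sup>2" if \<delta>: "0 < \<delta>" "\<delta> < \<alpha>max" for \<delta>
  proof -
    have \<delta>': "\<delta> \<in> {0<..<\<alpha>max}" using \<delta> by simp
    have "hanke_raus A X1 X2 (\<alpha>star \<delta>) (y\<delta> \<delta>) \<le> hanke_raus A X1 X2 \<delta> (y\<delta> \<delta>)"
      using \<alpha>star_min[OF \<delta>(1)] \<delta>' unfolding is_arg_min_linorder by blast
    then have "\<psi> \<delta> \<le> 1 / \<delta> * (res2 \<delta> (y\<delta> \<delta>) \<bullet> res1 \<delta> (y\<delta> \<delta>))"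
      by (simp add: hanke_raus_def \<psi>_def p2\<delta>_def p\<delta>_def res1_def res2_def)
    also have "\<dots> \<le> 1 / \<delta> * (\<delta> * (1 + norm w))\<^sup>2"
    proof (rule mult_left_mono)
      have "norm (res1 \<delta> (y\<delta> \<delta>) - res1 \<delta> y) \<le> \<delta>"
        using res1_nonexpansive[OF \<delta>', of "y\<delta> \<delta>" y] noise[OF \<delta>(1)] by simp
      moreover have "norm (res1 \<delta> y) \<le> \<delta> * norm w"
        using norm_res1_le[OF \<delta>' w] by (simp add: y)
      ultimately have res1: "norm (res1 \<delta> (y\<delta> \<delta>)) \<le> \<delta> * (1 + norm w)"
        using norm_triangle_sub[of "res1 \<delta> (y\<delta> \<delta>)" "res1 \<delta> y"] by (simp add: distrib_left)
      have "res2 \<delta> (y\<delta> \<delta>) \<bullet> res1 \<delta> (y\<delta> \<delta>) \<le> norm (res2 \<delta> (y\<delta> \<delta>)) * norm (res1 \<delta> (y\<delta> \<delta>))"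
        by (rule norm_cauchy_schwarz)
      also have "\<dots> \<le> (\<delta> * (1 + norm w)) * (\<delta> * (1 + norm w))"
        using norm_res2_le[OF \<delta>', of "y\<delta> \<delta>"] res1 \<delta> by (intro mult_mono) auto
      finally show "res2 \<delta> (y\<delta> \<delta>) \<bullet> res1 \<delta> (y\<delta> \<delta>) \<le> (\<delta> * (1 + norm w))\<^sup>2"
        by (simp add: power2_eq_square)
    qed (use \<delta> in simp)
    also have "\<dots> = \<delta> * (1 + norm w)\<^sup>2"
      using \<delta> by (simp add: power2_eq_square)
    finally show ?thesis .
  qed
  have small: "\<forall>\<^sub>F \<delta> in at_right 0. 0 < \<delta> \<and> \<delta> < \<alpha>max"
    using \<alpha>max_pos eventually_at_right_field by blast
  have pos: "\<forall>\<^sub>F \<delta> in at_right (0::real). 0 < \<delta>"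
    by (simp add: eventually_at_right_less)
  have id_lim: "((\<lambda>\<delta>. \<delta>) \<longlongrightarrow> 0) (at_right (0::real))" by (rule tendsto_ident_at)
  have \<psi>_lim: "(\<psi> \<longlongrightarrow> 0) (at_right 0)"
  proof (rule tendsto_sandwich)
    show "\<forall>\<^sub>F \<delta> in at_right 0. 0 \<le> \<psi> \<delta>"
      using pos by eventually_elim (rule \<psi>_nonneg)
    show "\<forall>\<^sub>F \<delta> in at_right 0. \<psi> \<delta> \<le> \<delta> * (1 + norm w)\<^sup>2"
      using small by eventually_elim (simp add: \<psi>_le)
    show "((\<lambda>\<delta>. \<delta> * (1 + norm w)\<^sup>2) \<longlongrightarrow> 0) (at_right 0)"
      using tendsto_mult_left_zero[OF id_lim] .
  qed simp
  have p2\<delta>_lim: "((\<lambda>\<delta>. norm (p2\<delta> \<delta>)) \<longlongrightarrow> 0) (at_right 0)"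
  proof (rule tendsto_sandwich[where f = "\<lambda>_. 0"])
    show "\<forall>\<^sub>F \<delta> in at_right 0. norm (p2\<delta> \<delta>) \<le> sqrt (\<alpha>max * \<psi> \<delta>)"
      using pos by eventually_elim (rule real_le_rsqrt, rule \<psi>_nonneg)
    show "((\<lambda>\<delta>. sqrt (\<alpha>max * \<psi> \<delta>)) \<longlongrightarrow> 0) (at_right 0)"
      using tendsto_real_sqrt[OF tendsto_mult_right_zero[OF \<psi>_lim]] by simp
  qed simp_all
  have p2_lim: "((\<lambda>\<delta>. norm (p2 \<delta>)) \<longlongrightarrow> 0) (at_right 0)"
  proof (rule tendsto_sandwich[where f = "\<lambda>_. 0"])
    show "\<forall>\<^sub>F \<delta> in at_right 0. norm (p2 \<delta>) \<le> norm (p2\<delta> \<delta>) + 3 * \<delta>"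
      using pos
    proof eventually_elim
      case (elim \<delta>)
      then show ?case
        using res2_lipschitz[OF as[OF elim], of y "y\<delta> \<delta>"] noise[OF elim]
          norm_triangle_sub[of "p2 \<delta>" "p2\<delta> \<delta>"]
        by (simp add: p2_def p2\<delta>_def norm_minus_commute)
    qed
    have "((\<lambda>\<delta>. norm (p2\<delta> \<delta>) + 3 * \<delta>) \<longlongrightarrow> 0 + 3 * 0) (at_right 0)"
      by (intro tendsto_intros p2\<delta>_lim)
    then show "((\<lambda>\<delta>. norm (p2\<delta> \<delta>) + 3 * \<delta>) \<longlongrightarrow> 0) (at_right 0)" by simp
  qed simp_all
  have p_lim: "((\<lambda>\<delta>. norm (p \<delta>)) \<longlongrightarrow> 0) (at_right 0)"
  proof (rule tendstoI)
    fix \<epsilon> :: real assume "0 < \<epsilon>"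
    then obtain \<eta> where \<eta>: "0 < \<eta>"
      "\<And>\<alpha>. \<alpha> \<in> {0<..<\<alpha>max} \<Longrightarrow> norm (res2 \<alpha> y) < \<eta> \<Longrightarrow> norm (res1 \<alpha> y) < \<epsilon>"
      using res1_small_of_res2_small[OF w b \<open>0 < C\<close>] C unfolding y by metis
    have "\<forall>\<^sub>F \<delta> in at_right 0. norm (p2 \<delta>) < \<eta>"
      using p2_lim \<eta>(1) by (rule order_tendstoD)
    then show "\<forall>\<^sub>F \<delta> in at_right 0. dist (norm (p \<delta>)) 0 < \<epsilon>"
      using pos by eventually_elim (use \<eta>(2) as in \<open>simp add: p_def p2_def\<close>)
  qed

  define D where "D = (\<lambda>\<delta>. real_of_ereal (R (X1 (\<alpha>star \<delta>) (y\<delta> \<delta>))) - real_of_ereal (R xdag)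
      - w \<bullet> (A (X1 (\<alpha>star \<delta>) (y\<delta> \<delta>)) - y))"
  \<comment> \<open>No inverse power of \<open>\<alpha>star \<delta>\<close> occurs outside
    \<open>\<psi> \<delta>\<close>, so the bound also covers parameters tending to 0.\<close>
  define U where "U = (\<lambda>\<delta>. C * (\<psi> \<delta> + norm (p2\<delta> \<delta>) * norm w + norm w * (norm (p \<delta>) + \<delta>)
      + norm (p \<delta>) * norm w) + 2 * norm w * \<delta> + norm w * norm (p \<delta>))"
  have fin: "\<bar>R (X1 (\<alpha>star \<delta>) v)\<bar> \<noteq> \<infinity>" if "0 < \<delta>" for \<delta> v
    by (rule range_subgradient_finite[OF X1_subgradient[OF as[OF that]]])
  have D_eq: "bregman_dist R \<xi> (X1 (\<alpha>star \<delta>) (y\<delta> \<delta>)) xdag = ereal (D \<delta>)" if "0 < \<delta>" for \<delta>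
    using fin[OF that, of "y\<delta> \<delta>"] range_subgradient_finite[OF w]
    by (cases "R (X1 (\<alpha>star \<delta>) (y\<delta> \<delta>))"; cases "R xdag")
      (auto simp: bregman_dist_def D_def source dual_adjoint_apply blinfun.diff_right
          inner_diff_right y)
  have D_nonneg: "0 \<le> D \<delta>" if "0 < \<delta>" for \<delta>
    using range_subgradient_real_ineq[OF w fin[OF that, of "y\<delta> \<delta>"]] by (simp add: D_def y)
  have D_le: "D \<delta> \<le> U \<delta>" if "0 < \<delta>" for \<delta>
  proof -
    define a where "a = \<alpha>star \<delta>"
    have a: "a \<in> {0<..<\<alpha>max}" "0 < a" using as[OF that] by (auto simp: a_def)
    define q where "q = (1 / a) *\<^sub>R p \<delta>"
    have p: "p \<delta> = a *\<^sub>R q" using a by (simp add: q_def)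
    have q: "norm q \<le> norm w"
      using norm_res1_le[OF a(1) w] a by (simp add: q_def p_def y a_def field_simps)
    have sub: "range_subgradient A R (X1 a y) q"
      using X1_subgradient[OF a(1), of y] by (simp add: q_def p_def a_def)
    have p2: "norm (p2 \<delta>) \<le> norm (p \<delta>)" "norm ((1 / a) *\<^sub>R p2 \<delta>) \<le> norm w"
    proof -
      show le: "norm (p2 \<delta>) \<le> norm (p \<delta>)"
        unfolding p2_def p_def by (rule norm_res2_le[OF as[OF that]])
      have "norm ((1 / a) *\<^sub>R p2 \<delta>) \<le> norm q"
        using le a by (simp add: q_def divide_right_mono)
      then show "norm ((1 / a) *\<^sub>R p2 \<delta>) \<le> norm w" using q by simp
    qed
    have p\<delta>: "norm (p\<delta> \<delta>) \<le> norm (p \<delta>) + \<delta>"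
      using res1_nonexpansive[OF a(1), of "y\<delta> \<delta>" y] noise[OF that]
        norm_triangle_sub[of "p\<delta> \<delta>" "p \<delta>"] by (simp add: p_def p\<delta>_def a_def)
    let ?h = "\<lambda>v. real_of_ereal (R (X1 a v))"
    define d where "d = A (X1 a (y\<delta> \<delta>)) - A (X1 a y)"
    have "norm d \<le> \<delta>"
      using A_X1_nonexpansive[OF a(1), of "y\<delta> \<delta>" y] noise[OF that] by (simp add: d_def)

    have "?h (y\<delta> \<delta>) - ?h y - q \<bullet> d
        \<le> C * (1 / a) * ((p2\<delta> \<delta> - p2 \<delta>) \<bullet> (p\<delta> \<delta> - p \<delta>))"
      using C[OF a(1), of "y\<delta> \<delta>"]
      unfolding bregman_dist_X1[OF a(1)] ereal_less_eq
      by (simp add: q_def d_def p_def p\<delta>_def p2_def p2\<delta>_def a_def)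
    \<comment> \<open>Of the four products divided by \<open>a\<close>, the first is the Hanke-Raus
      value. In the others \<open>1 / a\<close> is absorbed by an exact-data residual, and the
      quotient is bounded by \<open>norm w\<close>.\<close>
    also have "\<dots> = C * (\<psi> \<delta> - p2\<delta> \<delta> \<bullet> q - ((1 / a) *\<^sub>R p2 \<delta>) \<bullet> p\<delta> \<delta> + p2 \<delta> \<bullet> q)"
      using a by (simp add: \<psi>_def a_def[symmetric] q_def inner_diff field_simps)
    also have "\<dots> \<le> C * (\<psi> \<delta> + norm (p2\<delta> \<delta>) * norm w + norm w * (norm (p \<delta>) + \<delta>)
        + norm (p \<delta>) * norm w)"
    proof (rule mult_left_mono)
      have cs: "\<bar>u \<bullet> v\<bar> \<le> m * n" if "norm u \<le> m" "norm v \<le> n" for u v :: 'y and m n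
        using Cauchy_Schwarz_ineq2[of u v] mult_mono[OF that] norm_ge_zero[of u] norm_ge_zero[of v] that
        by (smt (verit))
      show "\<psi> \<delta> - p2\<delta> \<delta> \<bullet> q - ((1 / a) *\<^sub>R p2 \<delta>) \<bullet> p\<delta> \<delta> + p2 \<delta> \<bullet> q
        \<le> \<psi> \<delta> + norm (p2\<delta> \<delta>) * norm w + norm w * (norm (p \<delta>) + \<delta>) + norm (p \<delta>) * norm w"
        using cs[OF order_refl q, of "p2\<delta> \<delta>"] cs[OF p2(2) p\<delta>] cs[OF p2(1) q] by linarith
    qed (use \<open>0 < C\<close> in simp)
    finally have 1: "?h (y\<delta> \<delta>) - ?h y - q \<bullet> d \<le> \<dots>" .

    have "?h y - real_of_ereal (R xdag) \<le> - (q \<bullet> p \<delta>)"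
      using range_subgradient_real_ineq[OF sub range_subgradient_finite[OF w]]
      by (simp add: A_X1 y p_def a_def)
    also have "\<dots> \<le> 0" using a by (simp add: p)
    finally have 2: "?h y - real_of_ereal (R xdag) \<le> 0" .

    \<comment> \<open>Three-point identity through \<open>X1 a y\<close>: the distance between noisy
      and exact iterates, a nonpositive difference of \<open>R\<close> values, and two inner
      products that vanish with \<delta> and \<open>p \<delta>\<close>.\<close>
    have "D \<delta> = ?h (y\<delta> \<delta>) - real_of_ereal (R xdag) - w \<bullet> (d - p \<delta>)"
      by (simp add: D_def d_def a_def A_X1 p_def)
    then have "D \<delta> = (?h (y\<delta> \<delta>) - ?h y - q \<bullet> d) + (?h y - real_of_ereal (R xdag))
        + (q - w) \<bullet> d + w \<bullet> p \<delta>"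
      by (simp add: inner_diff)
    moreover have "(q - w) \<bullet> d \<le> 2 * norm w * \<delta>"
    proof -
      have "norm (q - w) \<le> 2 * norm w" using norm_triangle_ineq4[of q w] q by simp
      then have "norm (q - w) * norm d \<le> 2 * norm w * \<delta>"
        using \<open>norm d \<le> \<delta>\<close> by (intro mult_mono) auto
      then show ?thesis using norm_cauchy_schwarz[of "q - w" d] by simp
    qed
    moreover have "w \<bullet> p \<delta> \<le> norm w * norm (p \<delta>)" by (rule norm_cauchy_schwarz)
    ultimately show ?thesis using 1 2 unfolding U_def by linarith
  qed
  have "(U \<longlongrightarrow> C * (0 + 0 * norm w + norm w * (0 + 0) + 0 * norm w) + 2 * norm w * 0 + norm w * 0)
      (at_right 0)"
    unfolding U_def by (intro tendsto_intros \<psi>_lim p2\<delta>_lim p_lim)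
  then have U_lim: "(U \<longlongrightarrow> 0) (at_right 0)" by simp
  have "(D \<longlongrightarrow> 0) (at_right 0)"
  proof (rule tendsto_sandwich)
    show "\<forall>\<^sub>F \<delta> in at_right 0. 0 \<le> D \<delta>"
      using pos by eventually_elim (rule D_nonneg)
    show "\<forall>\<^sub>F \<delta> in at_right 0. D \<delta> \<le> U \<delta>"
      using pos by eventually_elim (rule D_le)
  qed (simp_all add: U_lim)
  then have "((\<lambda>\<delta>. ereal (D \<delta>)) \<longlongrightarrow> ereal 0) (at_right 0)"
    by (rule tendsto_ereal)
  moreover have "\<forall>\<^sub>F \<delta> in at_right 0. ereal (D \<delta>) = bregman_dist R \<xi> (X1 (\<alpha>star \<delta>) (y\<delta> \<delta>)) xdag"
    using pos by eventually_elim (simp add: D_eq)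
  ultimately show ?thesis
    by (simp add: Lim_transform_eventually flip: zero_ereal_def)
qed

end
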